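(* Let $n\geq 1$ and suppose $\omega_1>0,\ \omega_2>0,\ \ldots,\ \omega_n>0$ are linearly independent over the rationals. Then there exist $\tau_1>0,\ \tau_2>0,\ \ldots,\ \tau_n>0$ and $a_1\in\mathbb{R},\ a_2\in\mathbb{R},\ \ldots,\ a_n\in\mathbb{R}$ such that the linear delay-differential equation $$\dot{x}(t)=a_1\,x(t-\tau_1)+a_2\,x(t-\tau_2)+\cdots+a_n\,x(t-\tau_n)$$ has solutions $x_j^{\pm}(t)=e^{\pm i\omega_j t}$ for all $j=1,\ldots,n$.
   Context: Solutions are understood as complex-valued functions of $t\in\mathbb{R}$ satisfying the equation. *)

theory Defs
  imports "HOL-Analysis.Analysis"
begin

definition rat_scale :: "rat \<Rightarrow> real \<Rightarrow> real" where
  "rat_scale q x = of_rat q * x"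

lemma vector_space_rat_scale: "vector_space rat_scale"
  by unfold_locales (auto simp: rat_scale_def of_rat_add of_rat_mult algebra_simps)

(* Linear independence of a finite family (not merely of its set of values) over the rationals;
   injectivity excludes repeated members. *)
definition rat_lin_indep :: "nat set \<Rightarrow> (nat \<Rightarrow> real) \<Rightarrow> bool" where
  "rat_lin_indep I \<omega> \<longleftrightarrow> inj_on \<omega> I \<and> module.independent rat_scale (\<omega> ` I)"

lemma rat_lin_indep_iff:
  assumes "finite I"
  shows "rat_lin_indep I \<omega> \<longleftrightarrow>
    (\<forall>q :: nat \<Rightarrow> rat. (\<Sum>i\<in>I. of_rat (q i) * \<omega> i) = 0 \<longrightarrow> (\<forall>i\<in>I. q i = 0))"
    (is "_ \<longleftrightarrow> ?R")
proof -
  interpret vector_space rat_scale by (rule vector_space_rat_scale)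
  show ?thesis
  proof
    assume L: "rat_lin_indep I \<omega>"
    then have inj: "inj_on \<omega> I" and ind: "independent (\<omega> ` I)"
      by (auto simp: rat_lin_indep_def)
    show ?R
    proof (intro allI impI ballI)
      fix q :: "nat \<Rightarrow> rat" and i
      assume s: "(\<Sum>i\<in>I. of_rat (q i) * \<omega> i) = 0" and i: "i \<in> I"
      define u where "u = q \<circ> the_inv_into I \<omega>"
      have "(\<Sum>v\<in>\<omega> ` I. rat_scale (u v) v) = (\<Sum>i\<in>I. of_rat (q i) * \<omega> i)"
        by (subst sum.reindex[OF inj])
          (auto simp: u_def rat_scale_def the_inv_into_f_f[OF inj] intro!: sum.cong)
      then have "u (\<omega> i) = 0"
        using independentD[OF ind, of "\<omega> ` I" u "\<omega> i"] assms s i by auto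
      then show "q i = 0" using i by (simp add: u_def the_inv_into_f_f[OF inj])
    qed
  next
    assume R: ?R
    have inj: "inj_on \<omega> I"
    proof (rule inj_onI, rule ccontr)
      fix i j assume ij: "i \<in> I" "j \<in> I" "\<omega> i = \<omega> j" "i \<noteq> j"
      define q :: "nat \<Rightarrow> rat" where "q k = (if k = i then 1 else if k = j then -1 else 0)" for k
      have "(\<Sum>k\<in>I. of_rat (q k) * \<omega> k) = (\<Sum>k\<in>{i,j}. of_rat (q k) * \<omega> k)"
        using ij assms by (intro sum.mono_neutral_right) (auto simp: q_def)
      also have "\<dots> = 0" using ij by (simp add: q_def)
      finally have "q i = 0" using R ij by blast
      then show False by (simp add: q_def)
    qed
    have "independent (\<omega> ` I)"
    proof (rule independent_if_scalars_zero)
      show "finite (\<omega> ` I)" using assms by simp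
      fix u x assume s: "(\<Sum>x\<in>\<omega> ` I. rat_scale (u x) x) = 0" and x: "x \<in> \<omega> ` I"
      have "(\<Sum>i\<in>I. of_rat (u (\<omega> i)) * \<omega> i) = 0"
        using s by (simp add: sum.reindex[OF inj] rat_scale_def)
      then have "\<forall>i\<in>I. u (\<omega> i) = 0" using R[rule_format, of "u \<circ> \<omega>"] by auto
      then show "u x = 0" using x by auto
    qed
    with inj show "rat_lin_indep I \<omega>" by (simp add: rat_lin_indep_def)
  qed
qed

definition dde_solution ::
  "nat \<Rightarrow> (nat \<Rightarrow> real) \<Rightarrow> (nat \<Rightarrow> real) \<Rightarrow> (real \<Rightarrow> complex) \<Rightarrow> bool" where
  "dde_solution n a \<tau> x \<longleftrightarrow>
    (\<forall>t. (x has_vector_derivative (\<Sum>k=1..n. of_real (a k) * x (t - \<tau> k))) (at t))"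

end

theory Submission
  imports Defs
begin

text \<open>
  The functions \<open>exp (\<plusminus>\<i>\<omega>\<^sub>j t)\<close> are solutions iff
  \<open>\<Sum>\<^sub>k a\<^sub>k exp (-\<i>\<omega>\<^sub>j\<tau>\<^sub>k) = \<i>\<omega>\<^sub>j\<close> for all \<open>j\<close>. If \<open>exp (-\<i>\<omega>\<^sub>j\<tau>\<^sub>k)\<close> were equal
  to \<open>\<i>\<epsilon>\<^sub>j\<^sub>k\<close> with the sign matrix \<open>\<epsilon>\<^sub>j\<^sub>k = 1\<close> for \<open>k \<le> j\<close> and \<open>-1\<close> otherwise, this would be the
  real invertible system \<open>\<epsilon>a = \<omega>\<close>, whose solution has no zero entry because the \<open>\<omega>\<^sub>j\<close> are positive and
  distinct. By Kronecker's theorem such delays exist up to an arbitrarily small error. At this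
  approximate solution the derivative with respect to \<open>(a, \<tau>)\<close> is nearly
  \<open>(b, s) \<mapsto> (\<i>(\<epsilon>b)\<^sub>j + \<omega>\<^sub>j(\<epsilon>(as))\<^sub>j)\<^sub>j\<close>, which is invertible since all \<open>a\<^sub>k \<noteq> 0\<close>; a contraction argument
  corrects \<open>(a, \<tau>)\<close> to an exact solution.
\<close>

section \<open>A fixed-point principle for finite families\<close>

text \<open>The sup distance is taken over the index set only, so the dimension need not be a type.\<close>
lemma contraction_fixpoint_sup:
  fixes T :: "('i \<Rightarrow> 'a::banach) \<Rightarrow> 'i \<Rightarrow> 'a"
  assumes I: "finite I" and R: "R \<ge> 0"
    and T0: "\<And>i. i \<in> I \<Longrightarrow> norm (T (\<lambda>_. 0) i) \<le> R / 2"
    and contr: "\<And>x y d i. \<lbrakk>\<And>i. i \<in> I \<Longrightarrow> norm (x i) \<le> R; \<And>i. i \<in> I \<Longrightarrow> norm (y i) \<le> R;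
        \<And>i. i \<in> I \<Longrightarrow> norm (x i - y i) \<le> d; i \<in> I\<rbrakk> \<Longrightarrow> norm (T x i - T y i) \<le> d / 2"
  obtains x where "\<And>i. i \<in> I \<Longrightarrow> norm (x i) \<le> R" "\<And>i. i \<in> I \<Longrightarrow> T x i = x i"
proof -
  define x where "x m = (T ^^ m) (\<lambda>_. 0)" for m
  have x0: "x 0 = (\<lambda>_. 0)" and xS: "x (Suc m) = T (x m)" for m
    by (simp_all add: x_def)
  have bd: "norm (x m i) \<le> R" if "i \<in> I" for m i
    using that
  proof (induction m arbitrary: i)
    case 0
    then show ?case using R by (simp add: x0)
  next
    case (Suc m)
    \<comment> \<open>The ball of radius \<open>R\<close> is invariant: half of \<open>R\<close>
      bounds the change from the zero family, \<open>T0\<close> gives the other half.\<close>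
    have "norm (T (x m) i - T (\<lambda>_. 0) i) \<le> R / 2"
      by (rule contr) (use Suc R in auto)
    moreover have "norm (T (x m) i) \<le> norm (T (x m) i - T (\<lambda>_. 0) i) + norm (T (\<lambda>_. 0) i)"
      by (metis diff_add_cancel norm_triangle_ineq)
    ultimately show ?case using T0[OF Suc.prems] by (simp add: xS)
  qed
  have step: "norm (x (Suc m) i - x m i) \<le> R * (1/2) ^ m" if "i \<in> I" for m i
    using that
  proof (induction m arbitrary: i)
    case 0
    then show ?case using T0[of i] R by (simp add: x0 xS)
  next
    case (Suc m)
    have "norm (T (x (Suc m)) i - T (x m) i) \<le> R * (1/2) ^ m / 2"
      by (rule contr) (use Suc bd in auto)
    then show ?case by (simp add: xS)
  qed
  have conv: "convergent (\<lambda>m. x m i)" if "i \<in> I" for i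
  proof -
    have "summable (\<lambda>m. x (Suc m) i - x m i)"
      by (rule summable_comparison_test'[where N = 0 and g = "\<lambda>m. R * (1/2) ^ m"])
        (use step[OF that] in \<open>auto intro!: summable_mult summable_geometric\<close>)
    moreover have "(\<Sum>k<m. x (Suc k) i - x k i) = x m i" for m
      by (induction m) (auto simp: x0)
    ultimately show ?thesis
      by (simp add: summable_iff_convergent)
  qed
  define l where "l i = lim (\<lambda>m. x m i)" for i
  have lim: "(\<lambda>m. x m i) \<longlonglongrightarrow> l i" if "i \<in> I" for i
    using conv[OF that] by (simp add: l_def convergent_LIMSEQ_iff)
  have lbd: "norm (l i) \<le> R" if "i \<in> I" for i
    by (rule Lim_norm_ubound[OF _ lim[OF that]]) (use bd that in auto)
  have "T l i = l i" if i: "i \<in> I" for i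
  proof -
    have "norm (T l i - l i) \<le> 0 + e" if e: "e > 0" for e
    proof -
      \<comment> \<open>\<open>contr\<close> needs a bound on all coordinates at once; finiteness of
        \<open>I\<close> gives a common \<open>N\<close>.\<close>
      have "\<forall>\<^sub>F m in sequentially. \<forall>i\<in>I. norm (x m i - l i) < e / 2"
        by (intro eventually_ball_finite[OF I] ballI, unfold dist_norm[symmetric])
          (rule tendstoD[OF lim], use e in auto)
      then obtain N where N: "\<And>m i. m \<ge> N \<Longrightarrow> i \<in> I \<Longrightarrow> norm (x m i - l i) < e / 2"
        by (auto simp: eventually_sequentially)
      have "norm (T (x N) i - T l i) \<le> e / 2 / 2"
        using bd lbd i less_imp_le[OF N[OF order_refl]] by (intro contr) auto
      moreover have "norm (T (x N) i - l i) < e / 2"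
        using N[of "Suc N"] i by (simp add: xS)
      moreover have "norm (T l i - l i) \<le> norm (T (x N) i - l i) + norm (T (x N) i - T l i)"
        using norm_triangle_ineq4[of "T (x N) i - l i" "T (x N) i - T l i"] by simp
      ultimately show ?thesis using e by simp
    qed
    then have "norm (T l i - l i) \<le> 0" by (rule field_le_epsilon)
    then show ?thesis by simp
  qed
  with lbd show thesis using that by blast
qed

section \<open>Simultaneous approximation of phases\<close>

lemma norm_exp_i_diff_le:
  fixes x y :: real
  shows "cmod (exp (\<i> * of_real x) - exp (\<i> * of_real y)) \<le> \<bar>x - y\<bar>"
proof -
  have "exp (\<i> * of_real x) - exp (\<i> * of_real y) =
      exp (\<i> * of_real y) * (exp (\<i> * of_real (x - y)) - 1)"
    by (simp add: algebra_simps flip: exp_add)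
  then have "cmod (exp (\<i> * of_real x) - exp (\<i> * of_real y)) = 2 * \<bar>sin ((x - y) / 2)\<bar>"
    by (simp only: norm_mult norm_exp_i_times dist_exp_i_1)
  also have "\<dots> \<le> \<bar>x - y\<bar>"
    using abs_sin_x_le_abs_x[of "(x - y) / 2"] by simp
  finally show ?thesis .
qed

text \<open>Brings the frequencies into the form used by Kronecker's theorem: indices from 0,
  integer relations, and angles in full turns (\<open>c\<close> becomes
  \<open>1 / (2 * pi)\<close>).\<close>

lemma rat_lin_indep_imp_int_independent:
  fixes \<omega> :: "nat \<Rightarrow> real"
  assumes "rat_lin_indep {1..n} \<omega>" "c \<noteq> 0"
  shows "module.independent (\<lambda>r. (*) (real_of_int r)) ((\<lambda>i. c * \<omega> (Suc i)) ` {..<n})"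
    and "inj_on (\<lambda>i. c * \<omega> (Suc i)) {..<n}"
proof -
  interpret module "(\<lambda>r. (*) (real_of_int r))"
    by (simp add: Modules.module.intro distrib_left mult.commute)
  show inj: "inj_on (\<lambda>i. c * \<omega> (Suc i)) {..<n}"
  proof (rule inj_onI)
    fix i j assume "i \<in> {..<n}" "j \<in> {..<n}" "c * \<omega> (Suc i) = c * \<omega> (Suc j)"
    moreover have "inj_on \<omega> {1..n}" using assms(1) by (simp add: rat_lin_indep_def)
    ultimately have "Suc i = Suc j" using assms(2) by (intro inj_onD[of \<omega> "{1..n}"]) auto
    then show "i = j" by simp
  qed
  have ind: "(\<Sum>i\<in>{1..n}. of_rat (q i) * \<omega> i) = 0 \<Longrightarrow> i \<in> {1..n} \<Longrightarrow> q i = 0" for q i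
    using assms by (simp add: rat_lin_indep_iff)
  have "u x = 0" if s: "(\<Sum>x\<in>(\<lambda>i. c * \<omega> (Suc i)) ` {..<n}. of_int (u x) * x) = 0"
    and x: "x \<in> (\<lambda>i. c * \<omega> (Suc i)) ` {..<n}" for u :: "real \<Rightarrow> int" and x
  proof -
    have "0 = (\<Sum>i<n. of_int (u (c * \<omega> (Suc i))) * (c * \<omega> (Suc i)))"
      using s by (simp add: sum.reindex[OF inj])
    also have "\<dots> = c * (\<Sum>i<n. of_int (u (c * \<omega> (Suc i))) * \<omega> (Suc i))"
      by (simp add: sum_distrib_left algebra_simps)
    also have "(\<Sum>i<n. of_int (u (c * \<omega> (Suc i))) * \<omega> (Suc i)) =
        (\<Sum>i\<in>{1..n}. of_rat (of_int (u (c * \<omega> i))) * \<omega> i)"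
      by (simp add: sum.atLeast1_atMost_eq)
    finally have "(\<Sum>i\<in>{1..n}. of_rat (of_int (u (c * \<omega> i))) * \<omega> i) = 0"
      using assms(2) by simp
    from ind[OF this] x show "u x = 0" by auto
  qed
  then show "independent ((\<lambda>i. c * \<omega> (Suc i)) ` {..<n})"
    by (subst dependent_finite) blast+
qed

text \<open>Kronecker's theorem gives a real \<open>t\<close> of uncontrolled size. Dirichlet's
  theorem supplies an arbitrarily large common almost-period of the rotations; adding it passes
  \<open>B\<close> and only doubles the error bound.\<close>

lemma kronecker_phases:
  fixes \<omega> \<phi> :: "nat \<Rightarrow> real"
  assumes ind: "rat_lin_indep {1..n} \<omega>" and e: "e > 0"
  obtains t where "t > B" "\<And>j. j \<in> {1..n} \<Longrightarrow>
    cmod (exp (- \<i> * of_real (\<omega> j) * of_real t) - exp (\<i> * of_real (\<phi> j))) < e"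
proof -
  define \<theta> where "\<theta> i = 1 / (2 * pi) * \<omega> (Suc i)" for i
  \<comment> \<open>Two errors below \<open>d\<close>, one from each theorem, are scaled by
    \<open>2 * pi\<close> and together stay below \<open>e\<close>.\<close>
  define d where "d = e / (4 * pi)"
  have d: "d > 0" using e by (simp add: d_def)
  have \<theta>: "module.independent (\<lambda>r. (*) (real_of_int r)) (\<theta> ` {..<n})" "inj_on \<theta> {..<n}"
    using rat_lin_indep_imp_int_independent[OF ind, of "1 / (2 * pi)"] by (simp_all add: \<theta>_def[abs_def])
  obtain t h where th: "\<And>i. i < n \<Longrightarrow> \<bar>t * \<theta> i - of_int (h i) - (- \<phi> (Suc i) / (2 * pi))\<bar> < d"
    using Kronecker_thm_1[OF \<theta> d, of "\<lambda>i. - \<phi> (Suc i) / (2 * pi)"] by metis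
  define M where "M = \<bar>t\<bar> + \<bar>B\<bar> + 1"
  obtain N :: nat where N: "N > 0" "1 / N < d"
    using d by (metis gr_zeroI inverse_eq_divide real_arch_inverse)
  obtain q p where q: "q > 0" and p: "\<And>i. i < n \<Longrightarrow> \<bar>of_int q * (M * \<theta> i) - of_int (p i)\<bar> < 1 / N"
    using Dirichlet_approx_simult[OF N(1), of n "\<lambda>i. M * \<theta> i"] by metis
  show thesis
  proof
    have "1 * M \<le> of_int q * M"
      by (rule mult_right_mono) (use q in \<open>auto simp: M_def\<close>)
    then show "t + of_int q * M > B" by (simp add: M_def)
  next
    fix j assume j: "j \<in> {1..n}"
    define i where "i = j - 1"
    have i: "i < n" "Suc i = j" using j by (auto simp: i_def)
    define s where "s = t + of_int q * M"
    define m where "m = h i + p i"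
    have "\<bar>s * \<theta> i - of_int m + \<phi> j / (2 * pi)\<bar> < 2 * d"
      using th[OF i(1)] p[OF i(1)] N(2) by (simp add: s_def m_def i(2) algebra_simps)
    then have "2 * pi * \<bar>s * \<theta> i - of_int m + \<phi> j / (2 * pi)\<bar> < 2 * pi * (2 * d)"
      by simp
    then have b: "\<bar>2 * pi * (s * \<theta> i - of_int m + \<phi> j / (2 * pi))\<bar> < e"
      by (simp add: d_def abs_mult)
    have "2 * pi * (s * \<theta> i - of_int m + \<phi> j / (2 * pi)) = \<omega> j * s - 2 * pi * of_int m + \<phi> j"
      by (simp add: \<theta>_def i(2) field_simps)
    with b have b: "\<bar>(2 * pi * of_int m - \<omega> j * s) - \<phi> j\<bar> < e"
      by simp
    have "exp (\<i> * of_real (2 * pi * of_int m - \<omega> j * s)) =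
        exp (- \<i> * of_real (\<omega> j) * of_real s + of_int (2 * m) * of_real pi * \<i>)"
      by (simp add: algebra_simps)
    also have "\<dots> = exp (- \<i> * of_real (\<omega> j) * of_real s) * exp (of_int (2 * m) * of_real pi * \<i>)"
      by (rule exp_add)
    also have "exp (of_int (2 * m) * of_real pi * \<i>) = (1 :: complex)"
      by (auto simp: exp_eq_1 intro!: exI[of _ m])
    finally have "exp (- \<i> * of_real (\<omega> j) * of_real s) = exp (\<i> * of_real (2 * pi * of_int m - \<omega> j * s))"
      by simp
    with norm_exp_i_diff_le[of "2 * pi * of_int m - \<omega> j * s" "\<phi> j"] b
    show "cmod (exp (- \<i> * of_real (\<omega> j) * of_real (t + of_int q * M)) - exp (\<i> * of_real (\<phi> j))) < e"
      by (simp add: s_def)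
  qed
qed

section \<open>The sign matrix and its inverse\<close>

definition step_sign :: "nat \<Rightarrow> nat \<Rightarrow> real" where
  "step_sign j k = (if k \<le> j then 1 else -1)"

text \<open>The inverse of the sign matrix: rows \<open>k - 1\<close> and \<open>k\<close> differ
  only in column \<open>k\<close>, by 2, and rows 1 and \<open>n\<close> add up to twice the first
  unit vector.\<close>

definition step_inv :: "nat \<Rightarrow> (nat \<Rightarrow> real) \<Rightarrow> nat \<Rightarrow> real" where
  "step_inv n v k = (if k = 1 then (v 1 + v n) / 2 else (v k - v (k - 1)) / 2)"

text \<open>The first \<open>j\<close> entries telescope to \<open>(v n + v j) / 2\<close>, so all
  of them sum to \<open>v n\<close>; the signed sum is twice the former minus the latter.\<close>

lemma step_sign_step_inv:
  assumes "j \<in> {1..n}"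
  shows "(\<Sum>k=1..n. step_sign j k * step_inv n v k) = v j"
proof -
  have pos: "1 \<le> j \<Longrightarrow> (\<Sum>k=1..j. step_inv n v k) = (v n + v j) / 2" for j
    by (induction rule: dec_induct) (auto simp: step_inv_def field_simps)
  have "(\<Sum>k=1..n. step_sign j k * step_inv n v k) =
      (\<Sum>k=1..j. step_inv n v k) - (\<Sum>k=Suc j..n. step_inv n v k)"
  proof -
    have "{1..n} = {1..j} \<union> {Suc j..n}" using assms by auto
    then have "(\<Sum>k=1..n. step_sign j k * step_inv n v k) =
      (\<Sum>k=1..j. step_sign j k * step_inv n v k) + (\<Sum>k=Suc j..n. step_sign j k * step_inv n v k)"
      by (simp add: sum.union_disjoint)
    then show ?thesis by (simp add: step_sign_def sum_negf)
  qed
  moreover have "(\<Sum>k=1..j. step_inv n v k) + (\<Sum>k=Suc j..n. step_inv n v k) = (\<Sum>k=1..n. step_inv n v k)"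
  proof -
    have "{1..n} = {1..j} \<union> {Suc j..n}" using assms by auto
    then show ?thesis by (simp add: sum.union_disjoint)
  qed
  ultimately show ?thesis using pos[of j] pos[of n] assms by (simp add: field_simps)
qed

lemma step_inv_diff: "step_inv n v k - step_inv n w k = step_inv n (\<lambda>j. v j - w j) k"
  by (simp add: step_inv_def field_simps)

lemma abs_step_inv_le:
  assumes "\<And>j. j \<in> {1..n} \<Longrightarrow> \<bar>v j\<bar> \<le> m" "k \<in> {1..n}"
  shows "\<bar>step_inv n v k\<bar> \<le> m"
proof (cases "k = 1")
  case True
  then show ?thesis using assms(1)[of 1] assms(1)[of n] assms(2) by (simp add: step_inv_def)
next
  case False
  then have "\<bar>v (k - 1)\<bar> \<le> m" using assms by (intro assms(1)) auto
  then show ?thesis using False assms(1)[OF assms(2)] by (simp add: step_inv_def)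
qed

section \<open>The characteristic equation and its linearization\<close>

text \<open>The linear model has \<open>p\<close> in place of \<open>c\<close>. Since
  \<open>c - p\<close>, \<open>b'\<close>, \<open>s\<close> and \<open>s'\<close> are all at most
  \<open>r\<close> in size, its error has a Lipschitz constant proportional to \<open>r\<close>,
  which is what a contraction needs.\<close>

lemma delayed_term_linearization:
  fixes c p :: complex and w W a b b' s s' r d :: real
  assumes w: "0 \<le> w" "w \<le> W" and a: "\<bar>a\<bar> \<le> W" and p: "cmod p = 1" and c: "cmod (c - p) \<le> r"
    and r: "r \<le> 1" and bs: "\<bar>b'\<bar> \<le> r" "\<bar>s\<bar> \<le> r" "\<bar>s'\<bar> \<le> r"
    and d: "\<bar>b - b'\<bar> \<le> d" "\<bar>s - s'\<bar> \<le> d"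
  defines "g \<equiv> \<lambda>s. c * exp (- \<i> * of_real w * of_real s)"
  shows "cmod (of_real (a + b) * g s - of_real (a + b') * g s'
      - (p * of_real (b - b') - \<i> * p * of_real (w * (a * (s - s'))))) \<le> 3 * (1 + W) ^ 3 * r * d"
proof -
  define V where "V = 1 + W"
  have r0: "r \<ge> 0" and d0: "d \<ge> 0" and V: "V \<ge> 1" "W \<le> V" "w \<le> V"
    using bs d w by (auto simp: V_def)
  have g: "cmod (g x - p) \<le> V * r" if "\<bar>x\<bar> \<le> r" for x
  proof -
    have "g x - p = (c - p) * exp (\<i> * of_real (- w * x)) + p * (exp (\<i> * of_real (- w * x)) - exp (\<i> * of_real 0))"
      by (simp add: g_def algebra_simps)
    then have "cmod (g x - p) \<le> cmod ((c - p) * exp (\<i> * of_real (- w * x)))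
        + cmod (p * (exp (\<i> * of_real (- w * x)) - exp (\<i> * of_real 0)))"
      by (metis norm_triangle_ineq)
    also have "\<dots> = cmod (c - p) + cmod (exp (\<i> * of_real (- w * x)) - exp (\<i> * of_real 0))"
      by (simp only: norm_mult p norm_exp_i_times mult_1 mult_1_right)
    also have "\<dots> \<le> r + w * \<bar>x\<bar>"
      using norm_exp_i_diff_le[of "- w * x" 0] c w by (auto simp: abs_mult)
    also have "\<dots> \<le> r + W * r"
      using that w r0 by (intro add_left_mono mult_mono) auto
    finally show ?thesis by (simp add: V_def algebra_simps)
  qed
  \<comment> \<open>\<open>h\<close> is \<open>g\<close> without the model's linear term; its
    derivative is \<open>- \<i> * w * (g x - p)\<close>, of order \<open>r\<close>.\<close>
  define h where "h x = g x + \<i> * of_real w * p * of_real x" for x :: real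
  have h: "cmod (h s - h s') \<le> V * (V * r) * \<bar>s - s'\<bar>"
  proof -
    have "norm (h s - h s') \<le> V * (V * r) * norm (s - s')"
    proof (rule differentiable_bound[where S = "{-r..r}"])
      fix x assume x: "x \<in> {-r..r}"
      have "(h has_vector_derivative (- \<i> * of_real w * (g x - p))) (at x within {-r..r})"
        unfolding h_def g_def
        by (rule has_vector_derivative_real_field) (auto intro!: derivative_eq_intros simp: algebra_simps)
      then show "(h has_derivative (\<lambda>y. y *\<^sub>R (- \<i> * of_real w * (g x - p)))) (at x within {-r..r})"
        by (simp add: has_vector_derivative_def)
      show "onorm (\<lambda>y. y *\<^sub>R (- \<i> * of_real w * (g x - p))) \<le> V * (V * r)"
      proof (rule onorm_bound)
        show "0 \<le> V * (V * r)" using V r0 by simp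
        fix y :: real
        have "norm (y *\<^sub>R (- \<i> * of_real w * (g x - p))) = (w * cmod (g x - p)) * \<bar>y\<bar>"
          using w by (simp add: norm_mult)
        also have "\<dots> \<le> (V * (V * r)) * \<bar>y\<bar>"
          using g[of x] x V w r0 by (intro mult_right_mono mult_mono) auto
        finally show "norm (y *\<^sub>R (- \<i> * of_real w * (g x - p))) \<le> V * (V * r) * norm y" by simp
      qed
    qed (use bs in auto)
    then show ?thesis by simp
  qed
  \<comment> \<open>Three errors: \<open>g\<close> is not \<open>p\<close>, its slope is not the
    model's, and the model multiplies \<open>s - s'\<close> by \<open>a\<close> instead of
    \<open>a + b'\<close>. Each is at most \<open>V ^ 3 * r * d\<close>.\<close>
  have "of_real (a + b) * g s - of_real (a + b') * g s'
      - (p * of_real (b - b') - \<i> * p * of_real (w * (a * (s - s'))))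
    = of_real (b - b') * (g s - p) + of_real (a + b') * (h s - h s')
      - \<i> * p * of_real (w * b' * (s - s'))" (is "?l = ?x + ?y - ?z")
    by (simp add: h_def algebra_simps)
  then have "cmod ?l \<le> cmod ?x + cmod ?y + cmod ?z"
    using norm_triangle_ineq4[of "?x + ?y" ?z] norm_triangle_ineq[of ?x ?y] by simp
  moreover have "cmod ?x \<le> d * (V * r)"
    unfolding norm_mult norm_of_real using g[of s] bs d d0 by (intro mult_mono) auto
  moreover have "cmod ?y \<le> V * (V * (V * r) * d)"
  proof -
    have "cmod (h s - h s') \<le> V * (V * r) * d"
      using h d(2) V r0 by (meson mult_left_mono order_trans mult_nonneg_nonneg zero_le_one)
    moreover have "\<bar>a + b'\<bar> \<le> V" using a bs r by (simp add: V_def)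
    ultimately show ?thesis
      unfolding norm_mult norm_of_real using V by (intro mult_mono) auto
  qed
  moreover have "cmod ?z \<le> V * r * d"
    unfolding norm_mult norm_of_real abs_mult using p w V bs d r0 d0
    by (simp add: mult_mono)
  moreover have "V * r * d \<le> V ^ 3 * (r * d)"
    using V r0 d0 power_increasing[of 1 3 V] by (simp add: mult.assoc mult_right_mono)
  ultimately show ?thesis by (simp add: V_def[symmetric] power3_eq_cube algebra_simps)
qed

text \<open>The hypothesis is the characteristic equation; \<open>exp (z * t)\<close> factors out of
  every delayed term.\<close>

lemma dde_solution_exp:
  assumes "(\<Sum>k=1..n. of_real (a k) * exp (- z * of_real (\<tau> k))) = z"
  shows "dde_solution n a \<tau> (\<lambda>t. exp (z * of_real t))"
proof -
  have "(\<Sum>k=1..n. of_real (a k) * exp (z * of_real (t - \<tau> k))) = z * exp (z * of_real t)" for t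
  proof -
    have "(\<Sum>k=1..n. of_real (a k) * exp (z * of_real (t - \<tau> k))) =
        (\<Sum>k=1..n. of_real (a k) * exp (- z * of_real (\<tau> k))) * exp (z * of_real t)"
      unfolding sum_distrib_right
      by (intro sum.cong) (simp_all add: algebra_simps exp_diff exp_minus divide_inverse)
    with assms show ?thesis by simp
  qed
  moreover have "((\<lambda>t. exp (z * of_real t)) has_vector_derivative z * exp (z * of_real t)) (at t)" for t
    by (rule has_vector_derivative_real_field) (auto intro!: derivative_eq_intros)
  ultimately show ?thesis by (simp add: dde_solution_def)
qed


section \<open>Construction of the coefficients and delays\<close>

theorem theorem2p1:
  fixes n :: nat and \<omega> :: "nat \<Rightarrow> real"
  assumes "n \<ge> 1"
    and "\<forall>j\<in>{1..n}. \<omega> j > 0"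
    and "rat_lin_indep {1..n} \<omega>"
  shows "\<exists>(\<tau> :: nat \<Rightarrow> real) (a :: nat \<Rightarrow> real).
    (\<forall>k\<in>{1..n}. \<tau> k > 0) \<and>
    (\<forall>j\<in>{1..n}.
      dde_solution n a \<tau> (\<lambda>t. exp (\<i> * of_real (\<omega> j) * of_real t)) \<and>
      dde_solution n a \<tau> (\<lambda>t. exp (- \<i> * of_real (\<omega> j) * of_real t)))"
proof -
  let ?I = "{1..n}"
  have pos: "\<And>j. j \<in> ?I \<Longrightarrow> \<omega> j > 0" and inj: "inj_on \<omega> ?I" and n1: "1 \<in> ?I" "n \<in> ?I"
    using assms by (auto simp: rat_lin_indep_def)
  define a where "a = step_inv n \<omega>"
  have a0: "a k \<noteq> 0" if k: "k \<in> ?I" for k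
  proof (cases "k = 1")
    case True
    then show ?thesis using pos[OF n1(1)] pos[OF n1(2)] by (simp add: a_def step_inv_def)
  next
    case False
    then have "k - 1 \<in> ?I" "k - 1 \<noteq> k" using k by auto
    then have "\<omega> (k - 1) \<noteq> \<omega> k" using inj k by (meson inj_onD)
    then show ?thesis using False by (simp add: a_def step_inv_def)
  qed
  \<comment> \<open>The extremes of \<open>S\<close> bound all \<open>\<omega> j\<close> and
    \<open>\<bar>a k\<bar>\<close> on both sides; the element 1 forces
    \<open>W \<ge> 1\<close>.\<close>
  define S where "S = insert 1 (\<omega> ` ?I \<union> (\<lambda>k. \<bar>a k\<bar>) ` ?I)"
  have S: "finite S" "S \<noteq> {}" "\<forall>x\<in>S. x > 0" using pos a0 by (auto simp: S_def)
  define \<delta> where "\<delta> = Min S"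
  define W where "W = Max S"
  have \<delta>: "\<delta> > 0" "\<And>j. j \<in> ?I \<Longrightarrow> \<delta> \<le> \<omega> j" "\<And>k. k \<in> ?I \<Longrightarrow> \<delta> \<le> \<bar>a k\<bar>"
  proof -
    have "\<delta> \<in> S" unfolding \<delta>_def using S by (intro Min_in)
    then show "\<delta> > 0" using S(3) by blast
    have "\<And>x. x \<in> S \<Longrightarrow> \<delta> \<le> x" unfolding \<delta>_def using S(1) by (rule Min_le)
    then show "\<And>j. j \<in> ?I \<Longrightarrow> \<delta> \<le> \<omega> j" "\<And>k. k \<in> ?I \<Longrightarrow> \<delta> \<le> \<bar>a k\<bar>" by (simp_all add: S_def)
  qed
  have W: "W \<ge> 1" "\<And>j. j \<in> ?I \<Longrightarrow> \<omega> j \<le> W" "\<And>k. k \<in> ?I \<Longrightarrow> \<bar>a k\<bar> \<le> W"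
  proof -
    have "\<And>x. x \<in> S \<Longrightarrow> x \<le> W" unfolding W_def using S(1) by (rule Max_ge)
    then show "W \<ge> 1" "\<And>j. j \<in> ?I \<Longrightarrow> \<omega> j \<le> W" "\<And>k. k \<in> ?I \<Longrightarrow> \<bar>a k\<bar> \<le> W" by (simp_all add: S_def)
  qed
  \<comment> \<open>A bound for the norm of \<open>Linv\<close>: 1 for its real part,
    \<open>1 / \<delta>\<^sup>2\<close> for its imaginary part, which divides by
    \<open>\<omega> j\<close> and \<open>a k\<close>.\<close>
  define C where "C = 1 + 1 / \<delta>\<^sup>2"
  have C: "C \<ge> 1" by (simp add: C_def)
  define K where "K = 3 * (1 + W) ^ 3"
  have K: "K \<ge> 0" using W by (simp add: K_def)
  \<comment> \<open>Small enough that corrections stay within \<open>C * R \<le> 1\<close> and that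
    \<open>T\<close> below has Lipschitz constant at most 1/2.\<close>
  define R where "R = 1 / (2 * n * K * C\<^sup>2 + C)"
  have R: "R > 0" "C * R \<le> 1" "n * K * C\<^sup>2 * R \<le> 1 / 2"
  proof -
    have "2 * n * K * C\<^sup>2 \<ge> 0" using K by simp
    then have D: "2 * n * K * C\<^sup>2 + C > 0" "2 * n * K * C\<^sup>2 + C \<ge> C" using C by linarith+
    then show "R > 0" "C * R \<le> 1" by (simp_all add: R_def)
    show "n * K * C\<^sup>2 * R \<le> 1 / 2" using D(1) C by (simp add: R_def divide_simps)
  qed
  define p where "p j k = \<i> * of_real (step_sign j k)" for j k
  have p1: "cmod (p j k) = 1" for j k by (simp add: p_def norm_mult step_sign_def)
  have p_exp: "p j k = exp (\<i> * of_real (step_sign j k * pi / 2))" for j k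
    unfolding cis_conv_exp[symmetric] by (simp add: p_def step_sign_def complex_eq_iff)
  \<comment> \<open>The \<open>n\<close> initial errors, each at most \<open>W * \<eta>\<close>,
    then sum to at most \<open>R / 2\<close>.\<close>
  define \<eta> where "\<eta> = R / (2 * n * W)"
  have \<eta>: "\<eta> > 0" "\<eta> \<le> C * R" "n * W * \<eta> = R / 2"
  proof -
    show "\<eta> > 0" "n * W * \<eta> = R / 2" using R W assms(1) by (simp_all add: \<eta>_def)
    have "1 * 1 \<le> n * W" using assms(1) W by (intro mult_mono) auto
    then have "R / (2 * n * W) \<le> R / 1"
      using R W assms(1) by (intro divide_left_mono) auto
    also have "\<dots> \<le> C * R" using C R by simp
    finally show "\<eta> \<le> C * R" by (simp add: \<eta>_def)
  qed
  \<comment> \<open>One application of Kronecker's theorem per column \<open>k\<close>;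
    \<open>t > 1\<close> leaves room for a correction of size up to 1.\<close>
  have "\<exists>t>1. \<forall>j\<in>?I. cmod (exp (- \<i> * of_real (\<omega> j) * of_real t) - p j k) \<le> \<eta>" for k
    using kronecker_phases[OF assms(3) \<eta>(1), of 1 "\<lambda>j. step_sign j k * pi / 2"]
    by (metis p_exp less_imp_le)
  then obtain \<tau> where \<tau>: "\<And>k. \<tau> k > 1"
    and \<tau>p: "\<And>j k. j \<in> ?I \<Longrightarrow> cmod (exp (- \<i> * of_real (\<omega> j) * of_real (\<tau> k)) - p j k) \<le> \<eta>"
    by metis
  define c where "c j k = exp (- \<i> * of_real (\<omega> j) * of_real (\<tau> k))" for j k
  \<comment> \<open>The corrections \<open>b\<^sub>k\<close> to \<open>a\<^sub>k\<close> and \<open>s\<^sub>k\<close> to \<open>\<tau>\<^sub>k\<close> are packed into \<open>z\<^sub>k = b\<^sub>k + \<i>s\<^sub>k\<close>.\<close>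
  define F where "F z j = (\<Sum>k\<in>?I. of_real (a k + Re (z k)) *
      (c j k * exp (- \<i> * of_real (\<omega> j) * of_real (Im (z k))))) - \<i> * of_real (\<omega> j)"
    for z :: "nat \<Rightarrow> complex" and j
  \<comment> \<open>The derivative of \<open>F\<close> at zero correction, with the phases
    \<open>c\<close> replaced by their targets \<open>p\<close>.\<close>
  define L where "L z j = (\<Sum>k\<in>?I. p j k * of_real (Re (z k))
      - \<i> * p j k * of_real (\<omega> j * (a k * Im (z k))))" for z :: "nat \<Rightarrow> complex" and j
  \<comment> \<open>As \<open>p\<close> is \<open>\<i>\<close> times a sign, the system decouples:
    the imaginary part of \<open>L z j\<close> is the sign matrix applied to
    \<open>Re (z k)\<close>, the real part is \<open>\<omega> j\<close> times the sign matrix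
    applied to \<open>a k * Im (z k)\<close>.\<close>
  define Linv where "Linv w k = Complex (step_inv n (\<lambda>j. Im (w j)) k)
      (step_inv n (\<lambda>j. Re (w j) / \<omega> j) k / a k)" for w :: "nat \<Rightarrow> complex" and k
  have L_Linv: "L (Linv w) j = w j" if j: "j \<in> ?I" for w j
  proof -
    have "L (Linv w) j = \<i> * of_real (\<Sum>k\<in>?I. step_sign j k * step_inv n (\<lambda>j. Im (w j)) k)
        + of_real (\<omega> j) * of_real (\<Sum>k\<in>?I. step_sign j k * step_inv n (\<lambda>j. Re (w j) / \<omega> j) k)"
      unfolding L_def Linv_def of_real_sum sum_distrib_left sum.distrib[symmetric]
      using a0 by (intro sum.cong) (auto simp: p_def)
    also have "\<dots> = w j"
      unfolding step_sign_step_inv[OF j] using pos[OF j] by (simp add: complex_eq_iff)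
    finally show ?thesis .
  qed
  have Linv_diff: "Linv w k - Linv w' k = Linv (\<lambda>j. w j - w' j) k" for w w' k
    by (simp add: Linv_def complex_eq_iff step_inv_diff flip: diff_divide_distrib)
  have Linv_bound: "cmod (Linv w k) \<le> C * m"
    if w: "\<And>j. j \<in> ?I \<Longrightarrow> cmod (w j) \<le> m" and k: "k \<in> ?I" for w m k
  proof -
    have m0: "m \<ge> 0" using w[OF k] norm_ge_zero order_trans by blast
    have im: "\<bar>Im (w j)\<bar> \<le> m" if "j \<in> ?I" for j
      using abs_Im_le_cmod[of "w j"] w[OF that] by linarith
    have re: "\<bar>Re (Linv w k)\<bar> \<le> m"
      using abs_step_inv_le[OF im k] by (simp add: Linv_def)
    have div: "\<bar>Re (w j) / \<omega> j\<bar> \<le> m / \<delta>" if "j \<in> ?I" for j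
      unfolding abs_divide
      using abs_Re_le_cmod[of "w j"] w[OF that] \<delta>(1) \<delta>(2)[OF that] m0 by (intro frac_le) auto
    have "\<bar>Im (Linv w k)\<bar> \<le> m / \<delta> / \<delta>"
      unfolding Linv_def complex.sel abs_divide
      using \<delta>(1) \<delta>(3)[OF k] m0 abs_step_inv_le[OF div k] by (intro frac_le) auto
    with re show ?thesis
      using cmod_le[of "Linv w k"] by (simp add: C_def algebra_simps power2_eq_square)
  qed
  \<comment> \<open>A simplified Newton map in the variable \<open>w = L z\<close>: its fixed points
    solve \<open>F (Linv w) j = 0\<close>, and it contracts because \<open>F\<close> after
    \<open>Linv\<close> is close to the identity up to a constant.\<close>
  define T where "T w j = w j - F (Linv w) j" for w j
  obtain w where w: "\<And>j. j \<in> ?I \<Longrightarrow> cmod (w j) \<le> R" and Tw: "\<And>j. j \<in> ?I \<Longrightarrow> T w j = w j"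
  proof (rule contraction_fixpoint_sup[of ?I R T])
    fix j assume j: "j \<in> ?I"
    have "Linv (\<lambda>_. 0) = (\<lambda>_. 0)" by (auto simp: Linv_def complex_eq_iff step_inv_def)
    moreover have "(\<Sum>k\<in>?I. of_real (a k) * p j k) = \<i> * of_real (\<omega> j)"
      using arg_cong[OF step_sign_step_inv[OF j, of \<omega>], of "\<lambda>x. \<i> * of_real x"]
      by (simp add: p_def a_def sum_distrib_left algebra_simps)
    ultimately have "T (\<lambda>_. 0) j = - (\<Sum>k\<in>?I. of_real (a k) * (c j k - p j k))"
      by (simp add: T_def F_def algebra_simps sum_subtractf)
    also have "cmod \<dots> \<le> (\<Sum>k\<in>?I. W * \<eta>)"
      unfolding norm_minus_cancel
      using \<tau>p[OF j] W by (intro sum_norm_le) (auto simp: norm_mult c_def intro!: mult_mono)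
    finally show "cmod (T (\<lambda>_. 0) j) \<le> R / 2" using \<eta>(3) by (simp add: mult.assoc)
  next
    fix x y d j
    assume x: "\<And>i. i \<in> ?I \<Longrightarrow> cmod (x i) \<le> R" and y: "\<And>i. i \<in> ?I \<Longrightarrow> cmod (y i) \<le> R"
      and d: "\<And>i. i \<in> ?I \<Longrightarrow> cmod (x i - y i) \<le> d" and j: "j \<in> ?I"
    have d0: "d \<ge> 0" using d[OF j] norm_ge_zero order_trans by blast
    define u v where "u = Linv x" and "v = Linv y"
    have u: "\<bar>Re (u k)\<bar> \<le> C * R" "\<bar>Im (u k)\<bar> \<le> C * R" if "k \<in> ?I" for k
      using Linv_bound[of x R k] x that abs_Re_le_cmod[of "u k"] abs_Im_le_cmod[of "u k"]
      by (auto simp: u_def intro: order_trans)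
    have v: "\<bar>Re (v k)\<bar> \<le> C * R" "\<bar>Im (v k)\<bar> \<le> C * R" if "k \<in> ?I" for k
      using Linv_bound[of y R k] y that abs_Re_le_cmod[of "v k"] abs_Im_le_cmod[of "v k"]
      by (auto simp: v_def intro: order_trans)
    have "cmod (u k - v k) \<le> C * d" if "k \<in> ?I" for k
      using Linv_bound[of "\<lambda>j. x j - y j" d k] d that by (simp add: u_def v_def Linv_diff)
    then have uv: "\<bar>Re (u k) - Re (v k)\<bar> \<le> C * d" "\<bar>Im (u k) - Im (v k)\<bar> \<le> C * d" if "k \<in> ?I" for k
      using that abs_Re_le_cmod[of "u k - v k"] abs_Im_le_cmod[of "u k - v k"]
      by (auto intro: order_trans)
    define G where "G z k = of_real (a k + Re (z k)) *
      (c j k * exp (- \<i> * of_real (\<omega> j) * of_real (Im (z k))))" for z :: "nat \<Rightarrow> complex" and k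
    \<comment> \<open>Writing \<open>x j - y j\<close> through \<open>L\<close> turns the difference
      of \<open>T\<close> into a sum of linearization remainders, with \<open>C * R\<close> as
      \<open>r\<close> and \<open>C * d\<close> as \<open>d\<close>.\<close>
    have "x j - y j = L (\<lambda>k. u k - v k) j"
      using L_Linv[OF j, of "\<lambda>j. x j - y j"] by (simp add: u_def v_def Linv_diff)
    then have "T x j - T y j = - (\<Sum>k\<in>?I. G u k - G v k - (p j k * of_real (Re (u k) - Re (v k))
      - \<i> * p j k * of_real (\<omega> j * (a k * (Im (u k) - Im (v k))))))"
      by (simp add: T_def F_def L_def G_def u_def[symmetric] v_def[symmetric] sum_subtractf)
    also have "cmod \<dots> \<le> (\<Sum>k\<in>?I. K * (C * R) * (C * d))"
      unfolding norm_minus_cancel G_def K_def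
      using \<tau>p[OF j] \<eta>(2) W pos j u v uv p1 R
      by (intro sum_norm_le delayed_term_linearization)
         (auto simp: c_def less_imp_le intro: order_trans)
    also have "\<dots> = (n * K * C\<^sup>2 * R) * d" by (simp add: power2_eq_square)
    also have "\<dots> \<le> 1 / 2 * d" using R(3) d0 by (rule mult_right_mono)
    finally show "cmod (T x j - T y j) \<le> d / 2" by simp
  qed (use R in auto)
  define z where "z = Linv w"
  define \<tau>' where "\<tau>' k = \<tau> k + Im (z k)" for k
  define a' where "a' k = a k + Re (z k)" for k
  have root: "(\<Sum>k=1..n. of_real (a' k) * exp (- (\<i> * of_real (\<omega> j)) * of_real (\<tau>' k))) = \<i> * of_real (\<omega> j)"
    if j: "j \<in> ?I" for j
  proof -
    have "F z j = 0" using Tw[OF j] by (simp add: T_def z_def)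
    moreover have "c j k * exp (- \<i> * of_real (\<omega> j) * of_real (Im (z k))) =
        exp (- (\<i> * of_real (\<omega> j)) * of_real (\<tau>' k))" for k
      by (simp add: c_def \<tau>'_def algebra_simps flip: exp_add)
    ultimately show ?thesis by (simp add: F_def a'_def)
  qed
  have "\<tau>' k > 0" if k: "k \<in> ?I" for k
  proof -
    have "\<bar>Im (z k)\<bar> \<le> C * R"
      using Linv_bound[of w R k] w k abs_Im_le_cmod[of "z k"] by (auto simp: z_def intro: order_trans)
    then show ?thesis using \<tau>[of k] R(2) by (simp add: \<tau>'_def)
  qed
  moreover have "dde_solution n a' \<tau>' (\<lambda>t. exp (\<i> * of_real (\<omega> j) * of_real t))" if "j \<in> ?I" for j
    using root[OF that] by (rule dde_solution_exp)
  moreover have "dde_solution n a' \<tau>' (\<lambda>t. exp (- \<i> * of_real (\<omega> j) * of_real t))" if "j \<in> ?I" for j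
  proof (rule dde_solution_exp)
    \<comment> \<open>As \<open>a'\<close> and \<open>\<tau>'\<close> are real, this is the complex
      conjugate of \<open>root\<close>.\<close>
    show "(\<Sum>k=1..n. of_real (a' k) * exp (- (- \<i> * of_real (\<omega> j)) * of_real (\<tau>' k))) = - \<i> * of_real (\<omega> j)"
      using arg_cong[OF root[OF that], of cnj] by (simp add: exp_cnj)
  qed
  ultimately show ?thesis by blast
qed

end
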